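(* Let $i\ge 1$ be an integer and $\Delta t>0$. Assume that $\|\nabla r\|_{L^\infty}$ and $\|\mathcal L_\mu^i\mu\|_{L^\infty}$ are finite and that $\|\nabla\mu\|_{L^\infty}<\beta$. Let $V$ be the value function of the deterministic dynamics $\frac{d}{dt}s_t=\mu(s_t)$ and let $\hat V_i$ be the solution of the $i$-th order PhiBE $$\beta\hat V_i(s)=r(s)+\hat\mu_i(s)\cdot\nabla\hat V_i(s).$$ Then $$\|\hat V_i-V\|_{L^\infty}\le 2C_i\,\frac{\|\nabla r\|_{L^\infty}\,\|\mathcal L_\mu^i\mu\|_{L^\infty}}{(\beta-\|\nabla\mu\|_{L^\infty})^2}\,\Delta t^i,\qquad C_i=\frac{\sum_{j=0}^i|a^{(i)}_j|\,j^{i+1}}{(i+1)!}.$$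
   Context: Setting: $\beta>0$; $r:\mathbb R^d\to\mathbb R$ is bounded; $\mu:\mathbb R^d\to\mathbb R^d$ is Lipschitz; $s_t$ solves the ODE $\frac{d}{dt}s_t=\mu(s_t)$; $V(s)=\int_0^\infty e^{-\beta t}r(s_t)\,dt$ with $s_0=s$ (which satisfies $\beta V=r+\mu\cdot\nabla V$). $p_{\Delta t}(s)$ denotes the time-$\Delta t$ flow map of the ODE. The operator $\mathcal L_\mu=\mu\cdot\nabla$ acts componentwise on vector functions, and $\mathcal L_\mu^i$ is its $i$-th power. Coefficients: $a^{(i)}_0,\dots,a^{(i)}_i$ are the unique reals with $\sum_{j=0}^i a^{(i)}_j j^k=1$ if $k=1$ and $=0$ if $k\ne1$, for $0\le k\le i$ (with $0^0=1$). The approximate drift is $$\hat\mu_i(s)=\frac1{\Delta t}\sum_{j=1}^i a^{(i)}_j\Big(\underbrace{p_{\Delta t}\circ\cdots\circ p_{\Delta t}}_{j}(s)-s\Big).$$ The solution $\hat V_i$ of the PhiBE is the one given equivalently by $\hat V_i(s)=\int_0^\infty e^{-\beta t}r(\hat s_t)\,dt$ with $\frac{d}{dt}\hat s_t=\hat\mu_i(\hat s_t)$, $\hat s_0=s$. Norms: for scalar $f$, $\|f\|_{L^\infty}=\sup_s|f(s)|$; for vector functions $\|f\|_{L^\infty}=\sqrt{\sum_k\|f_k\|_{L^\infty}^2}$, and analogously (over all entries) for matrix functions. $(\nabla\mu)_{kl}=\partial_{s_k}\mu_l$. *)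

theory Defs
  imports "HOL-Analysis.Analysis"
begin

section \<open>Differential operators\<close>

definition grad :: "(real^'d \<Rightarrow> real) \<Rightarrow> real^'d \<Rightarrow> real^'d" where
  "grad f s = (\<chi> k. frechet_derivative f (at s) (axis k 1))"

text \<open>Row index: direction of differentiation; column index: component of the function.\<close>
definition grad_vec :: "(real^'d \<Rightarrow> real^'d) \<Rightarrow> real^'d \<Rightarrow> real^'d^'d" where
  "grad_vec f s = (\<chi> k l. grad (\<lambda>x. f x $ l) s $ k)"

definition lie_op :: "(real^'d \<Rightarrow> real^'d) \<Rightarrow> (real^'d \<Rightarrow> real^'d) \<Rightarrow> real^'d \<Rightarrow> real^'d" where
  "lie_op \<mu> f s = (\<chi> l. \<mu> s \<bullet> grad (\<lambda>x. f x $ l) s)"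


section \<open>Supremum norms\<close>

text \<open>These are real suprema, hence meaningful only for bounded functions; the statement always
  accompanies them with boundedness of the range.\<close>

definition Linf :: "(real^'d \<Rightarrow> real) \<Rightarrow> real" where
  "Linf f = (SUP s. \<bar>f s\<bar>)"

definition Linf_vec :: "(real^'d \<Rightarrow> real^'d) \<Rightarrow> real" where
  "Linf_vec f = sqrt (\<Sum>k\<in>UNIV. (Linf (\<lambda>s. f s $ k))\<^sup>2)"

definition Linf_mat :: "(real^'d \<Rightarrow> real^'d^'d) \<Rightarrow> real" where
  "Linf_mat f = sqrt (\<Sum>k\<in>UNIV. \<Sum>l\<in>UNIV. (Linf (\<lambda>s. f s $ k $ l))\<^sup>2)"


section \<open>Flow and value function\<close>

definition ode_solution :: "(real^'d \<Rightarrow> real^'d) \<Rightarrow> real^'d \<Rightarrow> (real \<Rightarrow> real^'d) \<Rightarrow> bool" where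
  "ode_solution F x X \<longleftrightarrow>
     X 0 = x \<and> (\<forall>t\<ge>0. (X has_vector_derivative F (X t)) (at t within {0..}))"

text \<open>For Lipschitz \<open>F\<close> the solution exists and is unique on \<open>{0..}\<close>; as it is not determined at
  negative times, the description ranges over its value at \<open>t\<close> (with \<open>t \<ge> 0\<close> intended).\<close>
definition ode_flow :: "(real^'d \<Rightarrow> real^'d) \<Rightarrow> real \<Rightarrow> real^'d \<Rightarrow> real^'d" where
  "ode_flow F t x = (THE y. \<exists>X. ode_solution F x X \<and> X t = y)"

definition value_fun ::
  "real \<Rightarrow> (real^'d \<Rightarrow> real) \<Rightarrow> (real^'d \<Rightarrow> real^'d) \<Rightarrow> real^'d \<Rightarrow> real" where
  "value_fun \<beta> r F s = (LINT t:{0..}|lborel. exp (- \<beta> * t) * r (ode_flow F t s))"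


section \<open>PhiBE of order \<open>i\<close>\<close>

text \<open>Only the coefficients with index at most \<open>i\<close> are meaningful; the others are set to 0 so that
  the description is unique.\<close>
definition phibe_coeff :: "nat \<Rightarrow> nat \<Rightarrow> real" where
  "phibe_coeff i = (THE a. (\<forall>j>i. a j = 0) \<and>
     (\<forall>k\<le>i. (\<Sum>j=0..i. a j * real j ^ k) = (if k = 1 then 1 else 0)))"

definition phibe_drift ::
  "nat \<Rightarrow> real \<Rightarrow> (real^'d \<Rightarrow> real^'d) \<Rightarrow> real^'d \<Rightarrow> real^'d" where
  "phibe_drift i \<Delta> \<mu> s =
     (1 / \<Delta>) *\<^sub>R (\<Sum>j=1..i. phibe_coeff i j *\<^sub>R ((ode_flow \<mu> \<Delta> ^^ j) s - s))"

text \<open>The solution of \<open>\<beta> V = r + phibe_drift i \<Delta> \<mu> \<bullet> \<nabla>V\<close>, in its representation as the discounted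
  integral along the characteristics.\<close>
definition phibe_solution ::
  "nat \<Rightarrow> real \<Rightarrow> real \<Rightarrow> (real^'d \<Rightarrow> real) \<Rightarrow> (real^'d \<Rightarrow> real^'d) \<Rightarrow> real^'d \<Rightarrow> real" where
  "phibe_solution i \<Delta> \<beta> r \<mu> = value_fun \<beta> r (phibe_drift i \<Delta> \<mu>)"

definition phibe_const :: "nat \<Rightarrow> real" where
  "phibe_const i = (\<Sum>j=0..i. \<bar>phibe_coeff i j\<bar> * real j ^ (i + 1)) / fact (i + 1)"

end

theory Submission
  imports Defs "HOL-Real_Asymp.Real_Asymp"
begin

text \<open>Along a trajectory of \<open>\<mu>\<close> the time derivative of order \<open>k + 1\<close> is the \<open>k\<close>-th Lie derivative of
  \<open>\<mu>\<close>. The moment conditions on the coefficients cancel every Taylor term of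
  \<open>phibe_drift i \<Delta> \<mu>\<close> except \<open>\<mu>\<close> itself, so the two drifts differ by at most
  \<open>\<epsilon> = C\<^sub>i \<Delta>\<^sup>i\<close> times the norm of the \<open>i\<close>-th Lie derivative. With \<open>M\<close> the norm of \<open>\<nabla>\<mu>\<close>, Gronwall
  keeps the two trajectories within \<open>\<epsilon> t e\<^sup>M\<^sup>t\<close> of each other; discounting at rate \<open>\<beta> > M\<close> and
  integrating gives the error \<open>\<epsilon> / (\<beta> - M)\<^sup>2\<close> per unit of the Lipschitz constant of \<open>r\<close>. This already
  proves the bound without the factor 2.\<close>

section \<open>Ordinary differential equations with Lipschitz right-hand side\<close>

text \<open>Formally the norm \<open>\<rho>\<close> of \<open>z\<close> satisfies
  \<open>\<rho>' \<le> \<epsilon> + M * \<rho>\<close>, so \<open>exp (- M * t) * \<rho> t\<close>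
  grows at rate at most \<open>\<epsilon> * exp (- M * t) \<le> \<epsilon>\<close>. Keeping the
  cruder rate \<open>\<epsilon>\<close> gives a form that covers \<open>M = 0\<close> as well and
  integrates in closed form against a discount factor.\<close>

lemma gronwall_norm:
  fixes z :: "real \<Rightarrow> 'a::real_inner"
  assumes deriv: "\<And>t. 0 \<le> t \<Longrightarrow> (z has_vector_derivative z' t) (at t within {0..})"
    and bound: "\<And>t. 0 \<le> t \<Longrightarrow> norm (z' t) \<le> \<epsilon> + M * norm (z t)"
    and "0 \<le> \<epsilon>" "0 \<le> M" "0 \<le> t"
  shows "norm (z t) \<le> exp (M * t) * (norm (z 0) + \<epsilon> * t)"
proof (cases "t = 0")
  case False
  with \<open>0 \<le> t\<close> have "0 < t" by simp
  have zcont: "continuous_on {0..t} z"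
    by (rule continuous_on_subset[of "{0..}"])
       (auto intro!: continuous_on_vector_derivative deriv)
  \<comment> \<open>The norm is regularised to be differentiable at zeros of \<open>z\<close>.\<close>
  have reg: "norm (z t) \<le> exp (M * t) * (sqrt ((norm (z 0))\<^sup>2 + \<delta>\<^sup>2) + \<epsilon> * t)"
    if "0 < \<delta>" for \<delta> :: real
  proof -
    define \<rho> where "\<rho> = (\<lambda>u. sqrt (z u \<bullet> z u + \<delta>\<^sup>2))"
    have rad_pos: "0 < z u \<bullet> z u + \<delta>\<^sup>2" for u
      using that by (intro add_nonneg_pos) auto
    have norm_le: "norm (z u) \<le> \<rho> u" for u
      unfolding \<rho>_def by (rule real_le_rsqrt) (simp add: power2_norm_eq_inner)
    have \<rho>_pos: "0 < \<rho> u" for u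
      using rad_pos by (simp add: \<rho>_def)
    \<comment> \<open>Monotonicity of \<open>\<psi>\<close> is the regularised claim, multiplied by
      the integrating factor \<open>exp (- M * t)\<close>.\<close>
    define \<psi> where "\<psi> = (\<lambda>u. \<epsilon> * u - exp (- M * u) * \<rho> u)"
    have "\<psi> 0 \<le> \<psi> t"
    proof (rule DERIV_nonneg_imp_increasing_open[OF \<open>0 \<le> t\<close>])
      show "continuous_on {0..t} \<psi>"
        unfolding \<psi>_def \<rho>_def by (intro continuous_intros zcont)
      fix u assume u: "0 < u" "u < t"
      have "(z has_vector_derivative z' u) (at u)"
        using deriv[of u] u by (simp add: at_within_interior[of u "{0..}"])
      then have "((\<lambda>u. z u \<bullet> z u) has_real_derivative 2 * (z u \<bullet> z' u)) (at u)"
        unfolding has_vector_derivative_def has_field_derivative_def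
        by (auto intro!: derivative_eq_intros simp: fun_eq_iff inner_commute)
      then have "(\<psi> has_real_derivative
          \<epsilon> - (exp (- M * u) * ((z u \<bullet> z' u) / \<rho> u) - M * exp (- M * u) * \<rho> u)) (at u)"
        unfolding \<psi>_def \<rho>_def using rad_pos[of u]
        by (auto intro!: derivative_eq_intros simp: field_simps)
      moreover have "0 \<le> \<epsilon> - (exp (- M * u) * ((z u \<bullet> z' u) / \<rho> u) - M * exp (- M * u) * \<rho> u)"
      proof -
        have "z u \<bullet> z' u \<le> norm (z u) * norm (z' u)"
          by (rule norm_cauchy_schwarz)
        also have "\<dots> \<le> \<rho> u * (\<epsilon> + M * \<rho> u)"
          using bound[of u] u mult_left_mono[OF norm_le[of u] \<open>0 \<le> M\<close>] \<rho>_pos[of u]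
          by (intro mult_mono norm_le) auto
        finally have "(z u \<bullet> z' u) / \<rho> u - M * \<rho> u \<le> \<epsilon>"
          using \<rho>_pos[of u] by (simp add: field_simps)
        then have "exp (- M * u) * ((z u \<bullet> z' u) / \<rho> u - M * \<rho> u) \<le> exp (- M * u) * \<epsilon>"
          by (intro mult_left_mono) auto
        also have "\<dots> \<le> 1 * \<epsilon>"
          using \<open>0 \<le> M\<close> \<open>0 \<le> \<epsilon>\<close> u by (intro mult_right_mono) auto
        finally show ?thesis by (simp add: algebra_simps)
      qed
      ultimately show "\<exists>y. (\<psi> has_real_derivative y) (at u) \<and> 0 \<le> y" by blast
    qed
    then have "exp (- M * t) * \<rho> t \<le> \<rho> 0 + \<epsilon> * t"
      by (simp add: \<psi>_def)
    then have "exp (M * t) * (exp (- M * t) * \<rho> t) \<le> exp (M * t) * (\<rho> 0 + \<epsilon> * t)"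
      by (intro mult_left_mono) auto
    moreover have "exp (M * t) * (exp (- M * t) * \<rho> t) = \<rho> t"
      by (simp add: mult.assoc[symmetric] mult_exp_exp)
    ultimately have "norm (z t) \<le> exp (M * t) * (\<rho> 0 + \<epsilon> * t)"
      using norm_le[of t] by linarith
    then show ?thesis
      by (simp add: \<rho>_def power2_norm_eq_inner)
  qed
  \<comment> \<open>The regularisation is removed by letting \<open>\<delta>\<close> tend to 0 from
    the right.\<close>
  have "((\<lambda>\<delta>. exp (M * t) * (sqrt ((norm (z 0))\<^sup>2 + \<delta>\<^sup>2) + \<epsilon> * t))
      \<longlongrightarrow> exp (M * t) * (sqrt ((norm (z 0))\<^sup>2 + 0\<^sup>2) + \<epsilon> * t)) (at_right (0::real))"
    by (intro tendsto_intros)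
  then have "norm (z t) \<le> exp (M * t) * (sqrt ((norm (z 0))\<^sup>2 + 0\<^sup>2) + \<epsilon> * t)"
    by (rule tendsto_lowerbound)
       (auto intro!: reg eventually_at_right_less[THEN eventually_mono])
  then show ?thesis by simp
qed simp

text \<open>Integration reproduces the exponential \<open>exp (K * u)\<close> and gains a factor
  \<open>1 / K\<close>. This gain makes Picard's operator contractive in an exponentially weighted
  norm.\<close>

lemma norm_integral_le_exp:
  fixes g :: "real \<Rightarrow> 'a::euclidean_space"
  assumes "continuous_on {0..} g" "\<And>u. 0 \<le> u \<Longrightarrow> norm (g u) \<le> B * exp (K * u)"
    and "0 < K" "0 \<le> t"
  shows "norm (integral {0..t} g) \<le> B / K * exp (K * t)"
proof -
  have cont: "continuous_on {0..t} g"
    using assms(1) by (rule continuous_on_subset) auto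
  have "((\<lambda>u. B * exp (K * u)) has_integral (B / K * exp (K * t) - B / K * exp (K * 0))) {0..t}"
    using assms by (intro fundamental_theorem_of_calculus)
      (auto intro!: derivative_eq_intros simp flip: has_real_derivative_iff_has_vector_derivative)
  then have "norm (integral {0..t} g) \<le> B / K * exp (K * t) - B / K"
    using integral_norm_bound_integral[OF integrable_continuous_real[OF cont], of "\<lambda>u. B * exp (K * u)"]
      assms by (auto simp: has_integral_iff)
  moreover have "0 \<le> B"
    using assms(2)[of 0] order_trans[OF norm_ge_zero] by simp
  ultimately show ?thesis
    using \<open>0 < K\<close> by (smt (verit) divide_nonneg_pos)
qed

text \<open>Banach's fixed point theorem in Bielecki's norm: weighting paths by
  \<open>exp (- K * t)\<close> makes Picard's operator a contraction on the whole half-line at once,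
  so no local solutions have to be glued.\<close>

lemma lipschitz_ode_solution_exists:
  fixes F :: "real^'d \<Rightarrow> real^'d"
  assumes "L-lipschitz_on UNIV F"
  shows "\<exists>X. ode_solution F x X"
proof -
  \<comment> \<open>Adding 1 keeps \<open>M\<close> and \<open>K\<close> positive when
    \<open>L = 0\<close>. With \<open>K = 2 * M\<close> the contraction factor \<open>M / K\<close>
    is 1/2.\<close>
  define M where "M = L + 1"
  define K where "K = 2 * M"
  have "0 \<le> L" using assms by (rule lipschitz_on_nonneg)
  then have "0 < M" "0 < K" by (auto simp: M_def K_def)
  have lip: "norm (F a - F b) \<le> M * norm (a - b)" for a b
  proof -
    have "norm (F a - F b) \<le> L * norm (a - b)"
      using lipschitz_onD[OF assms, of a b] by (simp add: dist_norm)
    then show ?thesis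
      unfolding M_def by (simp add: algebra_simps) (use norm_ge_zero[of "a - b"] in linarith)
  qed
  have contF: "continuous_on UNIV F"
    using assms by (rule lipschitz_on_continuous_on)
  define f :: "(real, real^'d) bcontfun \<Rightarrow> real \<Rightarrow> real^'d"
    where "f = (\<lambda>y u. F (exp (K * u) *\<^sub>R apply_bcontfun y u))"
  \<comment> \<open>Picard's operator on the rescaled path \<open>exp (-K t) X t\<close>; extended constantly to negative
    times, so that it acts on bounded continuous functions on the line.\<close>
  define G where "G = (\<lambda>y t. exp (- K * max 0 t) *\<^sub>R (x + integral {0..max 0 t} (f y)))"
  have contf: "continuous_on S (f y)" for y S
    unfolding f_def
    by (intro continuous_on_compose2[OF contF] continuous_intros) auto
  have deriv: "((\<lambda>t. integral {0..t} (f y)) has_vector_derivative f y t) (at t within {0..})"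
    if "0 \<le> t" for y t
  proof -
    \<comment> \<open>The fundamental theorem is applied on a compact interval reaching beyond
      \<open>t\<close>; near \<open>t\<close> it coincides with the half-line.\<close>
    have "((\<lambda>t. integral {0..t} (f y)) has_vector_derivative f y t) (at t within {0..t+1})"
      using that by (intro integral_has_vector_derivative contf) auto
    moreover have "at t within {0..t+1} = at t within {0..}"
      by (rule at_within_nhd[of _ "{..<t+1}"]) auto
    ultimately show ?thesis by simp
  qed
  have contI: "continuous_on {0..} (\<lambda>t. integral {0..t} (f y))" for y
    by (rule continuous_on_vector_derivative) (use deriv in auto)
  have f_bound: "norm (f y u) \<le> (norm (F 0) + M * norm y) * exp (K * u)" if "0 \<le> u" for y u
  proof -
    have "norm (f y u) \<le> norm (F 0) + norm (f y u - F 0)"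
      by (metis add.commute diff_add_cancel norm_triangle_ineq)
    also have "norm (f y u - F 0) \<le> M * (exp (K * u) * norm (apply_bcontfun y u))"
      using lip[of "exp (K * u) *\<^sub>R apply_bcontfun y u" 0] by (simp add: f_def)
    also have "\<dots> \<le> M * (exp (K * u) * norm y)"
      using \<open>0 < M\<close> by (intro mult_left_mono norm_bounded) auto
    also have "norm (F 0) \<le> norm (F 0) * exp (K * u)"
      using \<open>0 < K\<close> that by (simp add: mult_le_cancel_left1)
    finally show ?thesis by (simp add: algebra_simps)
  qed
  have G_bcont: "G y \<in> bcontfun" for y
  proof (rule bcontfun_normI)
    show "continuous_on UNIV (G y)"
      unfolding G_def
      by (intro continuous_intros continuous_on_compose2[OF contI]) auto
    fix t
    define B where "B = (norm (F 0) + M * norm y) / K"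
    have "norm (integral {0..max 0 t} (f y)) \<le> B * exp (K * max 0 t)"
      unfolding B_def by (rule norm_integral_le_exp[OF contf f_bound \<open>0 < K\<close>]) auto
    then have "norm (x + integral {0..max 0 t} (f y)) \<le> norm x + B * exp (K * max 0 t)"
      by (intro norm_triangle_le) simp
    then have "norm (G y t) \<le> exp (- K * max 0 t) * (norm x + B * exp (K * max 0 t))"
      unfolding G_def by (simp add: mult_left_mono)
    also have "\<dots> = exp (- K * max 0 t) * norm x + B"
      by (simp add: algebra_simps mult_exp_exp)
    also have "\<dots> \<le> 1 * norm x + B"
      using \<open>0 < K\<close> by (intro add_right_mono mult_right_mono) auto
    finally show "norm (G y t) \<le> norm x + B" by simp
  qed
  have "\<exists>!y. Bcontfun (G y) = y"
  proof (rule banach_fix_type[of "1 / 2"])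
    show "\<forall>y w. dist (Bcontfun (G y)) (Bcontfun (G w)) \<le> 1 / 2 * dist y w"
    proof (intro allI dist_bound)
      fix y w t
      have "norm (f y u - f w u) \<le> M * dist y w * exp (K * u)" for u
      proof -
        have "norm (f y u - f w u) \<le> M * (exp (K * u) * dist (apply_bcontfun y u) (apply_bcontfun w u))"
          using lip[of "exp (K * u) *\<^sub>R apply_bcontfun y u" "exp (K * u) *\<^sub>R apply_bcontfun w u"]
          by (simp add: f_def dist_norm flip: scaleR_diff_right)
        also have "\<dots> \<le> M * (exp (K * u) * dist y w)"
          using \<open>0 < M\<close> by (intro mult_left_mono dist_bounded) auto
        finally show ?thesis by (simp add: algebra_simps)
      qed
      then have "norm (integral {0..max 0 t} (\<lambda>u. f y u - f w u))
          \<le> M * dist y w / K * exp (K * max 0 t)"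
        using \<open>0 < K\<close> by (intro norm_integral_le_exp continuous_on_diff contf) auto
      then have "norm (integral {0..max 0 t} (f y) - integral {0..max 0 t} (f w))
          \<le> dist y w / 2 * exp (K * max 0 t)"
        using \<open>0 < M\<close>
        by (simp add: Henstock_Kurzweil_Integration.integral_diff integrable_continuous_real contf K_def)
      moreover have "G y t - G w t = exp (- K * max 0 t) *\<^sub>R
          (integral {0..max 0 t} (f y) - integral {0..max 0 t} (f w))"
        by (simp add: G_def algebra_simps)
      ultimately have "norm (G y t - G w t)
          \<le> exp (- K * max 0 t) * (dist y w / 2 * exp (K * max 0 t))"
        by (simp only: norm_scaleR) (auto intro: mult_left_mono)
      also have "\<dots> = 1 / 2 * dist y w"
        by (simp add: algebra_simps mult_exp_exp)
      finally show "dist (apply_bcontfun (Bcontfun (G y)) t) (apply_bcontfun (Bcontfun (G w)) t)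
          \<le> 1 / 2 * dist y w"
        by (simp add: Bcontfun_inverse G_bcont dist_norm)
    qed
  qed auto
  then obtain y where y: "Bcontfun (G y) = y" by blast
  then have y_eq: "apply_bcontfun y t = G y t" for t
    by (metis Bcontfun_inverse G_bcont)
  \<comment> \<open>\<open>X\<close> undoes the rescaling of the fixed point \<open>y\<close>. For
    nonnegative times the fixed point equation becomes the integral equation of the ODE.\<close>
  define X where "X = (\<lambda>t. x + integral {0..t} (f y))"
  have f_eq: "f y t = F (X t)" if "0 \<le> t" for t
  proof -
    have "f y t = F (exp (K * t) *\<^sub>R G y t)"
      by (simp add: f_def flip: y_eq)
    also have "exp (K * t) *\<^sub>R G y t = X t"
      using that by (simp add: G_def X_def mult_exp_exp)
    finally show ?thesis .
  qed
  have "(X has_vector_derivative F (X t)) (at t within {0..})" if "0 \<le> t" for t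
    unfolding X_def using deriv[OF that, of y] f_eq[OF that]
    by (auto intro!: derivative_eq_intros simp: X_def)
  then have "ode_solution F x X"
    by (simp add: ode_solution_def X_def)
  then show ?thesis by blast
qed

text \<open>Inserting \<open>G (X u)\<close> splits the difference of velocities into the drift
  error at \<open>X u\<close> and a Lipschitz term of \<open>G\<close>. The one estimate yields
  uniqueness (\<open>x = y\<close>, \<open>\<epsilon> = 0\<close>), dependence on the initial point
  (\<open>\<epsilon> = 0\<close>) and stability under a change of drift
  (\<open>x = y\<close>).\<close>

lemma ode_solution_diff_bound:
  fixes F G :: "real^'d \<Rightarrow> real^'d"
  assumes X: "ode_solution F x X" and Y: "ode_solution G y Y"
    and lip: "L-lipschitz_on UNIV G"
    and close: "\<And>s. norm (F s - G s) \<le> \<epsilon>"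
    and "0 \<le> t"
  shows "norm (X t - Y t) \<le> exp (L * t) * (norm (x - y) + \<epsilon> * t)"
proof -
  have "norm (X t - Y t) \<le> exp (L * t) * (norm (X 0 - Y 0) + \<epsilon> * t)"
  proof (rule gronwall_norm[where z = "\<lambda>t. X t - Y t" and z' = "\<lambda>t. F (X t) - G (Y t)"])
    fix u :: real assume "0 \<le> u"
    then show "((\<lambda>t. X t - Y t) has_vector_derivative F (X u) - G (Y u)) (at u within {0..})"
      using X Y by (auto simp: ode_solution_def intro!: derivative_intros)
    have "norm (F (X u) - G (Y u)) \<le> norm (F (X u) - G (X u)) + norm (G (X u) - G (Y u))"
      by (metis diff_add_cancel add_diff_eq norm_triangle_ineq)
    then show "norm (F (X u) - G (Y u)) \<le> \<epsilon> + L * norm (X u - Y u)"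
      using close[of "X u"] lipschitz_onD[OF lip, of "X u" "Y u"] by (simp add: dist_norm)
  next
    show "0 \<le> \<epsilon>" using close order_trans[OF norm_ge_zero] by blast
    show "0 \<le> L" using lip by (rule lipschitz_on_nonneg)
  qed fact
  then show ?thesis
    using X Y by (simp add: ode_solution_def)
qed

text \<open>Uniqueness makes the description in \<open>ode_flow\<close> denote, so that flows can be
  replaced by concrete trajectories from here on.\<close>

lemma ode_flow_eq:
  assumes X: "ode_solution F x X" and lip: "L-lipschitz_on UNIV F" and "0 \<le> t"
  shows "ode_flow F t x = X t"
  unfolding ode_flow_def
proof (rule the_equality)
  fix y assume "\<exists>Y. ode_solution F x Y \<and> Y t = y"
  then obtain Y where Y: "ode_solution F x Y" "Y t = y" by blast
  show "y = X t"
    using ode_solution_diff_bound[OF Y(1) X lip, of 0 t] \<open>0 \<le> t\<close> Y(2) by simp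
qed (use X in blast)

text \<open>The equation is autonomous, so restarting a trajectory at a later time gives a
  trajectory again.\<close>

lemma ode_solution_shift:
  assumes "ode_solution F x X" "0 \<le> u"
  shows "ode_solution F (X u) (\<lambda>t. X (u + t))"
  unfolding ode_solution_def
proof (intro conjI allI impI)
  fix t :: real assume "0 \<le> t"
  with assms have "(X has_vector_derivative F (X (u + t))) (at (u + t) within {0..})"
    by (simp add: ode_solution_def)
  then have "(X has_vector_derivative F (X (u + t))) (at (u + t) within (\<lambda>t. u + t) ` {0..})"
    by (rule has_vector_derivative_within_subset) (use \<open>0 \<le> u\<close> in auto)
  then have "((X \<circ> (\<lambda>t. u + t)) has_vector_derivative 1 *\<^sub>R F (X (u + t))) (at t within {0..})"
    by (intro vector_diff_chain_within) (auto intro!: derivative_eq_intros)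
  then show "((\<lambda>t. X (u + t)) has_vector_derivative F (X (u + t))) (at t within {0..})"
    by (simp add: o_def)
qed simp

text \<open>By the semigroup property the iterated flow maps in the approximate drift sample a
  single trajectory at equidistant times.\<close>

lemma ode_flow_funpow:
  assumes X: "ode_solution F x X" and lip: "L-lipschitz_on UNIV F" and "0 \<le> \<Delta>"
  shows "(ode_flow F \<Delta> ^^ j) x = X (real j * \<Delta>)"
proof (induction j)
  case 0
  show ?case using X by (simp add: ode_solution_def)
next
  case (Suc j)
  have "ode_flow F \<Delta> (X (real j * \<Delta>)) = X (real j * \<Delta> + \<Delta>)"
    by (rule ode_flow_eq[OF ode_solution_shift[OF X] lip]) (use \<open>0 \<le> \<Delta>\<close> in auto)
  then show ?case using Suc by (simp add: algebra_simps)
qed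

lemma lipschitz_ode_flow:
  assumes lip: "L-lipschitz_on UNIV F" and "0 \<le> t"
  shows "(exp (L * t))-lipschitz_on UNIV (ode_flow F t)"
proof (rule lipschitz_onI)
  fix x y
  obtain X Y where XY: "ode_solution F x X" "ode_solution F y Y"
    using lipschitz_ode_solution_exists[OF lip] by blast
  show "dist (ode_flow F t x) (ode_flow F t y) \<le> exp (L * t) * dist x y"
    using ode_solution_diff_bound[OF XY lip, of 0 t] \<open>0 \<le> t\<close>
    by (simp add: ode_flow_eq[OF XY(1) lip] ode_flow_eq[OF XY(2) lip] dist_norm)
qed simp

section \<open>Supremum norms and Lie derivatives\<close>

lemma Linf_upper:
  assumes "bounded (range f)"
  shows "\<bar>f s\<bar> \<le> Linf f"
proof -
  obtain b where "\<And>x. \<bar>f x\<bar> \<le> b"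
    using assms by (auto simp: bounded_iff)
  then show ?thesis
    unfolding Linf_def by (intro cSUP_upper bdd_aboveI2) auto
qed

lemma bounded_range_component:
  fixes f :: "'a \<Rightarrow> 'b::real_normed_vector^'d"
  assumes "bounded (range f)"
  shows "bounded (range (\<lambda>s. f s $ k))"
  using bounded_linear_image[OF assms bounded_linear_vec_nth] by (simp add: image_image)

lemma norm_le_Linf_vec:
  assumes "bounded (range f)"
  shows "norm (f s) \<le> Linf_vec f"
  unfolding norm_vec_def L2_set_def Linf_vec_def
  using Linf_upper[OF bounded_range_component[OF assms]]
  by (intro real_sqrt_le_mono sum_mono power_mono) auto

lemma norm_le_Linf_mat:
  assumes "bounded (range f)"
  shows "norm (f s) \<le> Linf_mat f"
proof -
  have "norm (f s) = sqrt (\<Sum>k\<in>UNIV. \<Sum>l\<in>UNIV. (f s $ k $ l)\<^sup>2)"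
    unfolding norm_vec_def L2_set_def by (simp add: sum_nonneg)
  also have "\<dots> \<le> Linf_mat f"
    unfolding Linf_mat_def
  proof (intro real_sqrt_le_mono sum_mono)
    fix k l
    show "(f s $ k $ l)\<^sup>2 \<le> (Linf (\<lambda>s. f s $ k $ l))\<^sup>2"
      using power_mono[OF Linf_upper[OF bounded_range_component[OF bounded_range_component[OF assms]],
            of s k l], of 2] by simp
  qed
  finally show ?thesis .
qed

lemma frechet_derivative_eq_grad:
  assumes "f differentiable (at s)"
  shows "frechet_derivative f (at s) v = grad f s \<bullet> v"
proof -
  interpret D: linear "frechet_derivative f (at s)"
    using assms by (rule linear_frechet_derivative)
  have "frechet_derivative f (at s) v = frechet_derivative f (at s) (\<Sum>k\<in>UNIV. (v $ k) *\<^sub>R axis k 1)"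
    by (simp add: basis_expansion flip: scalar_mult_eq_scaleR)
  also have "\<dots> = (\<Sum>k\<in>UNIV. v $ k * frechet_derivative f (at s) (axis k 1))"
    by (simp add: D.sum D.scaleR)
  finally show ?thesis
    by (simp add: grad_def inner_vec_def mult.commute)
qed

lemma has_derivative_grad:
  assumes "f differentiable (at s)"
  shows "(f has_derivative (\<lambda>v. grad f s \<bullet> v)) (at s)"
  using assms[unfolded frechet_derivative_works]
  by (simp add: frechet_derivative_eq_grad[OF assms, abs_def])

lemma has_derivative_grad_vec:
  fixes f :: "real^'d \<Rightarrow> real^'d"
  assumes "f differentiable (at s)"
  shows "(f has_derivative (\<lambda>v. \<chi> l. grad (\<lambda>x. f x $ l) s \<bullet> v)) (at s)"
proof (subst has_derivative_componentwise_within, intro ballI)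
  fix b :: "real^'d" assume "b \<in> Basis"
  then obtain l where b: "b = axis l 1" by (auto simp: Basis_vec_def)
  have "(\<lambda>x. f x $ l) differentiable (at s)"
    using differentiable_chain_at[OF assms
        bounded_linear_imp_differentiable[OF bounded_linear_vec_nth[of l]]] by (simp add: o_def)
  from has_derivative_grad[OF this]
  show "((\<lambda>x. f x \<bullet> b) has_derivative
      (\<lambda>x. (\<chi> l. grad (\<lambda>x. f x $ l) s \<bullet> x) \<bullet> b)) (at s)"
    by (simp add: b inner_axis)
qed

text \<open>Mean value inequality on the convex whole space, with Cauchy-Schwarz bounding the
  operator norm of the derivative by the Euclidean norm of the gradient.\<close>

lemma grad_bound_lipschitz:
  assumes "\<forall>s. r differentiable (at s)" "bounded (range (grad r))"
  shows "\<bar>r x - r y\<bar> \<le> Linf_vec (grad r) * norm (x - y)"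
proof -
  have "norm (r x - r y) \<le> Linf_vec (grad r) * norm (x - y)"
  proof (rule differentiable_bound[OF convex_UNIV])
    fix s
    show "(r has_derivative (\<lambda>v. grad r s \<bullet> v)) (at s within UNIV)"
      using assms(1) by (auto intro: has_derivative_grad)
    have "\<bar>grad r s \<bullet> v\<bar> \<le> Linf_vec (grad r) * norm v" for v
      using Cauchy_Schwarz_ineq2[of "grad r s" v] norm_le_Linf_vec[OF assms(2), of s]
      by (meson mult_right_mono norm_ge_zero order_trans)
    then show "onorm (\<lambda>v. grad r s \<bullet> v) \<le> Linf_vec (grad r)"
      by (intro onorm_bound order_trans[OF norm_ge_zero norm_le_Linf_vec[OF assms(2)]]) auto
  qed auto
  then show ?thesis by simp
qed

text \<open>The operator norm of the derivative is at most the Frobenius norm of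
  \<open>grad_vec f s\<close>, which in turn is at most the norm built from entrywise
  suprema.\<close>

lemma grad_vec_bound_lipschitz:
  assumes "\<forall>s. f differentiable (at s)" "bounded (range (grad_vec f))"
  shows "(Linf_mat (grad_vec f))-lipschitz_on UNIV f"
proof (rule lipschitz_onI)
  show nonneg: "0 \<le> Linf_mat (grad_vec f)"
    by (rule order_trans[OF norm_ge_zero norm_le_Linf_mat[OF assms(2)]])
  fix x y
  have "norm (f x - f y) \<le> Linf_mat (grad_vec f) * norm (x - y)"
  proof (rule differentiable_bound[OF convex_UNIV])
    fix s
    show "(f has_derivative (\<lambda>v. \<chi> l. grad (\<lambda>x. f x $ l) s \<bullet> v)) (at s within UNIV)"
      using assms(1) by (auto intro: has_derivative_grad_vec)
    have "norm (\<chi> l. grad (\<lambda>x. f x $ l) s \<bullet> v) \<le> Linf_mat (grad_vec f) * norm v" for v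
    proof -
      \<comment> \<open>As rows of \<open>grad_vec\<close> index the direction of differentiation,
        the derivative applied to \<open>v\<close> combines the rows with weights
        \<open>v $ k\<close>; Cauchy-Schwarz over the rows then applies.\<close>
      have "(\<chi> l. grad (\<lambda>x. f x $ l) s \<bullet> v) = (\<Sum>k\<in>UNIV. v $ k *\<^sub>R grad_vec f s $ k)"
        by (simp add: vec_eq_iff grad_vec_def inner_vec_def mult.commute)
      then have "norm (\<chi> l. grad (\<lambda>x. f x $ l) s \<bullet> v) \<le> (\<Sum>k\<in>UNIV. \<bar>v $ k\<bar> * norm (grad_vec f s $ k))"
        using norm_sum[of "\<lambda>k. v $ k *\<^sub>R grad_vec f s $ k" UNIV] by simp
      also have "\<dots> = (\<Sum>k\<in>UNIV. \<bar>norm (v $ k)\<bar> * \<bar>norm (grad_vec f s $ k)\<bar>)"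
        by simp
      also have "\<dots> \<le> norm v * norm (grad_vec f s)"
        unfolding norm_vec_def[of v] norm_vec_def[of "grad_vec f s"] by (rule L2_set_mult_ineq)
      also have "\<dots> \<le> norm v * Linf_mat (grad_vec f)"
        by (intro mult_left_mono norm_le_Linf_mat assms) auto
      finally show ?thesis by (simp add: mult.commute)
    qed
    then show "onorm (\<lambda>v. \<chi> l. grad (\<lambda>x. f x $ l) s \<bullet> v) \<le> Linf_mat (grad_vec f)"
      by (intro onorm_bound nonneg) auto
  qed auto
  then show "dist (f x) (f y) \<le> Linf_mat (grad_vec f) * dist x y"
    by (simp add: dist_norm)
qed

text \<open>Chain rule. Iterated from \<open>\<mu>\<close>, it identifies the higher time
  derivatives of a trajectory with Lie derivatives.\<close>

lemma lie_op_along_solution: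
  assumes X: "ode_solution \<mu> x X" and "0 \<le> t" and f: "f differentiable (at (X t))"
  shows "((\<lambda>t. f (X t)) has_vector_derivative lie_op \<mu> f (X t)) (at t within {0..})"
proof -
  have "((f \<circ> X) has_vector_derivative (\<chi> l. grad (\<lambda>x. f x $ l) (X t) \<bullet> \<mu> (X t))) (at t within {0..})"
    using X \<open>0 \<le> t\<close>
    by (intro vector_derivative_diff_chain_within
          has_derivative_at_withinI[OF has_derivative_grad_vec[OF f]])
       (simp add: ode_solution_def)
  then show ?thesis
    by (simp add: o_def lie_op_def inner_commute)
qed

section \<open>Accuracy of the approximate drift\<close>

text \<open>The moment conditions say that the weights at the nodes \<open>0, ..., i\<close> compute
  the linear coefficient, that is the derivative at 0, of every polynomial of degree at most
  \<open>i\<close>. Lagrange interpolation shows that these weights exist and are unique: they are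
  the linear coefficients of the basis polynomials.\<close>

lemma phibe_coeff_ex1:
  "\<exists>!a :: nat \<Rightarrow> real. (\<forall>j>i. a j = 0) \<and>
     (\<forall>k\<le>i. (\<Sum>j=0..i. a j * real j ^ k) = (if k = 1 then 1 else 0))"
proof -
  \<comment> \<open>The Lagrange basis polynomials of the nodes \<open>0, \<dots>, i\<close>.\<close>
  define l :: "nat \<Rightarrow> real poly" where
    "l = (\<lambda>j. smult (1 / (\<Prod>m\<in>{0..i} - {j}. real j - real m)) (\<Prod>m\<in>{0..i} - {j}. [:- real m, 1:]))"
  have poly_l: "poly (l j) (real m) = (if m = j then 1 else 0)" if "m \<le> i" "j \<le> i" for j m
  proof -
    have "(\<Prod>n\<in>{0..i} - {j}. real j - real n) \<noteq> 0" by auto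
    moreover have "(\<Prod>n\<in>{0..i} - {j}. real m - real n) = 0" if "m \<noteq> j"
      using that \<open>m \<le> i\<close> by auto
    ultimately show ?thesis by (simp add: l_def poly_prod)
  qed
  have degree_l: "degree (l j) \<le> i" if "j \<le> i" for j
  proof -
    have "degree (l j) \<le> (\<Sum>m\<in>{0..i} - {j}. degree [:- real m, 1:])"
      unfolding l_def
      by (intro order_trans[OF degree_smult_le] order_trans[OF degree_prod_sum_le]) (auto simp: o_def)
    also have "\<dots> \<le> i" using that by simp
    finally show ?thesis .
  qed
  define a where "a = (\<lambda>j. if j \<le> i then coeff (l j) 1 else 0)"
  have sum_a: "(\<Sum>j=0..i. a j * real j ^ k) = (if k = 1 then 1 else 0)" if "k \<le> i" for k
  proof -
    \<comment> \<open>Both sides have degree at most \<open>i\<close> and agree at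
      \<open>i + 1\<close> nodes; comparing linear coefficients gives the moment condition.\<close>
    have "monom 1 k = (\<Sum>j=0..i. smult (real j ^ k) (l j))"
    proof (rule poly_eqI_degree[of "real ` {0..i}"])
      fix x assume "x \<in> real ` {0..i}"
      then obtain m where "x = real m" "m \<le> i" by auto
      then show "poly (monom 1 k) x = poly (\<Sum>j=0..i. smult (real j ^ k) (l j)) x"
        by (simp add: poly_monom poly_sum poly_l if_distrib sum.delta cong: if_cong)
    next
      have card: "card (real ` {0..i}) = Suc i" by (simp add: card_image)
      show "degree (monom (1::real) k) < card (real ` {0..i})"
        using that by (simp add: card degree_monom_eq)
      have "degree (\<Sum>j=0..i. smult (real j ^ k) (l j)) \<le> i"
        by (intro degree_sum_le) (auto intro: order_trans[OF degree_smult_le] degree_l)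
      then show "degree (\<Sum>j=0..i. smult (real j ^ k) (l j)) < card (real ` {0..i})"
        by (simp add: card)
    qed
    from arg_cong[OF this, of "\<lambda>p. coeff p 1"] show ?thesis
      by (simp add: coeff_sum a_def mult.commute split: if_splits)
  qed
  show ?thesis
  proof (rule ex1I[of _ a])
    show "(\<forall>j>i. a j = 0) \<and> (\<forall>k\<le>i. (\<Sum>j=0..i. a j * real j ^ k) = (if k = 1 then 1 else 0))"
      using sum_a by (auto simp: a_def)
    fix b :: "nat \<Rightarrow> real"
    assume b: "(\<forall>j>i. b j = 0) \<and> (\<forall>k\<le>i. (\<Sum>j=0..i. b j * real j ^ k) = (if k = 1 then 1 else 0))"
    \<comment> \<open>Linearity extends the moment conditions from monomials to polynomials; testing
      with \<open>l m\<close> then isolates \<open>b m\<close>.\<close>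
    have sum_poly: "(\<Sum>j=0..i. b j * poly p (real j)) = coeff p 1" if "degree p \<le> i" for p
    proof -
      have "(\<Sum>j=0..i. b j * poly p (real j)) = (\<Sum>j=0..i. \<Sum>k\<le>degree p. coeff p k * (b j * real j ^ k))"
        by (simp add: poly_altdef sum_distrib_left algebra_simps)
      also have "\<dots> = (\<Sum>k\<le>degree p. coeff p k * (\<Sum>j=0..i. b j * real j ^ k))"
        by (subst sum.swap) (simp add: sum_distrib_left)
      also have "\<dots> = (\<Sum>k\<le>degree p. if k = 1 then coeff p 1 else 0)"
        using b that by (intro sum.cong) auto
      also have "\<dots> = coeff p 1"
        by (simp add: coeff_eq_0)
      finally show ?thesis .
    qed
    show "b = a"
    proof
      fix m
      show "b m = a m"
      proof (cases "m \<le> i")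
        case True
        have "(\<Sum>j=0..i. b j * poly (l m) (real j)) = (\<Sum>j=0..i. if j = m then b j else 0)"
          using True by (intro sum.cong) (auto simp: poly_l)
        with sum_poly[OF degree_l[OF True]] True show ?thesis
          by (simp add: a_def)
      qed (use b in \<open>simp add: a_def\<close>)
    qed
  qed
qed

lemma sum_phibe_coeff:
  assumes "k \<le> i"
  shows "(\<Sum>j=0..i. phibe_coeff i j * real j ^ k) = (if k = 1 then 1 else 0)"
  using theI'[OF phibe_coeff_ex1[of i]] assms unfolding phibe_coeff_def by blast

lemma lipschitz_on_sum:
  fixes f :: "'i \<Rightarrow> 'a::metric_space \<Rightarrow> 'b::real_normed_vector"
  assumes "\<And>i. i \<in> I \<Longrightarrow> (C i)-lipschitz_on U (f i)"
  shows "(\<Sum>i\<in>I. C i)-lipschitz_on U (\<lambda>x. \<Sum>i\<in>I. f i x)"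
  using assms
  by (induction I rule: infinite_finite_induct)
     (auto intro: lipschitz_on_add lipschitz_on_constant)

text \<open>Some Lipschitz constant suffices, whatever its size: it makes the trajectories of the
  approximate drift exist and be unique. The quantitative estimate relies on the constant of
  \<open>\<mu>\<close>.\<close>

lemma phibe_drift_lipschitz:
  assumes lip: "L-lipschitz_on UNIV \<mu>" and "0 \<le> \<Delta>"
  shows "\<exists>C. C-lipschitz_on UNIV (phibe_drift i \<Delta> \<mu>)"
proof -
  have pow: "(exp (L * \<Delta>) ^ j)-lipschitz_on UNIV (ode_flow \<mu> \<Delta> ^^ j)" for j
  proof (induction j)
    case 0
    then show ?case by (simp add: id_def lipschitz_on_id)
  next
    case (Suc j)
    then show ?case
      using lipschitz_on_compose[OF Suc lipschitz_on_subset[OF lipschitz_ode_flow[OF assms] subset_UNIV]]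
      by simp
  qed
  have "phibe_drift i \<Delta> \<mu> =
      (\<lambda>s. (1 / \<Delta>) *\<^sub>R (\<Sum>j=1..i. phibe_coeff i j *\<^sub>R ((ode_flow \<mu> \<Delta> ^^ j) s - s)))"
    by (simp add: phibe_drift_def fun_eq_iff)
  then have "(\<bar>1 / \<Delta>\<bar> * (\<Sum>j=1..i. \<bar>phibe_coeff i j\<bar> * (exp (L * \<Delta>) ^ j + 1)))-lipschitz_on UNIV
      (phibe_drift i \<Delta> \<mu>)"
    by (simp only:) (intro lipschitz_on_cmult lipschitz_on_sum lipschitz_on_diff lipschitz_on_id pow)
  then show ?thesis by blast
qed

lemma DERIV_power_fact:
  "((\<lambda>u::real. u ^ Suc k / fact (Suc k)) has_real_derivative u ^ k / fact k) (at u within S)"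
proof -
  have "((\<lambda>u::real. u ^ Suc k / fact (Suc k)) has_real_derivative
      real (Suc k) * u ^ k / fact (Suc k)) (at u within S)"
    by (rule DERIV_cdivide) (use DERIV_pow[of "Suc k" u S] in simp)
  moreover have "real (Suc k) * u ^ k / fact (Suc k) = u ^ k / fact k"
    by (simp del: of_nat_Suc)
  ultimately show ?thesis by (simp only:)
qed

text \<open>Induction on the order: the derivative of the Taylor remainder is the remainder of the
  shifted sequence \<open>f (Suc m)\<close>, one order lower. Its bound is integrated through the
  mean value inequality, which works for vector values.\<close>

lemma taylor_bound:
  fixes f :: "nat \<Rightarrow> real \<Rightarrow> 'a::real_normed_vector"
  assumes "\<And>m t. m < n \<Longrightarrow> 0 \<le> t \<Longrightarrow> (f m has_vector_derivative f (Suc m) t) (at t within {0..})"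
    and "\<And>t. 0 \<le> t \<Longrightarrow> norm (f n t) \<le> B"
    and "0 \<le> t"
  shows "norm (f 0 t - (\<Sum>k<n. (t ^ k / fact k) *\<^sub>R f k 0)) \<le> B * t ^ n / fact n"
  using assms
proof (induction n arbitrary: f t)
  case 0
  then show ?case by simp
next
  case (Suc n)
  show ?case
  proof (cases "t = 0")
    case True
    have "(\<Sum>k<Suc n. ((0::real) ^ k / fact k) *\<^sub>R f k 0) = f 0 0"
      by (simp only: sum.lessThan_Suc_shift) simp
    with True show ?thesis by simp
  next
    case False
    with \<open>0 \<le> t\<close> have "0 < t" by simp
    define g where "g = (\<lambda>u. f 0 u - (\<Sum>k<Suc n. (u ^ k / fact k) *\<^sub>R f k 0))"
    \<comment> \<open>This is the remainder of the shifted sequence, to which the induction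
      hypothesis applies.\<close>
    define g' where "g' = (\<lambda>u. f 1 u - (\<Sum>k<n. (u ^ k / fact k) *\<^sub>R f (Suc k) 0))"
    have g'_bound: "norm (g' u) \<le> B * u ^ n / fact n" if "0 \<le> u" for u
      unfolding g'_def
      using Suc.IH[of "\<lambda>m. f (Suc m)" u] Suc.prems that by simp
    have g: "(g has_vector_derivative g' u) (at u within {0..})" if "0 \<le> u" for u
    proof -
      have "((\<lambda>u. \<Sum>k<n. (u ^ Suc k / fact (Suc k)) *\<^sub>R f (Suc k) 0) has_vector_derivative
          (\<Sum>k<n. (u ^ k / fact k) *\<^sub>R f (Suc k) 0)) (at u within {0..})"
      proof (rule has_vector_derivative_sum)
        fix k
        have "((\<lambda>u. u ^ Suc k / fact (Suc k)) has_real_derivative u ^ k / fact k) (at u within {0..})"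
          by (rule DERIV_power_fact)
        then show "((\<lambda>u. (u ^ Suc k / fact (Suc k)) *\<^sub>R f (Suc k) 0) has_vector_derivative
            (u ^ k / fact k) *\<^sub>R f (Suc k) 0) (at u within {0..})"
          using has_vector_derivative_scaleR[OF _ has_vector_derivative_const] by force
      qed
      then have "((\<lambda>u. f 0 u - (f 0 0 + (\<Sum>k<n. (u ^ Suc k / fact (Suc k)) *\<^sub>R f (Suc k) 0)))
          has_vector_derivative f (Suc 0) u - (0 + (\<Sum>k<n. (u ^ k / fact k) *\<^sub>R f (Suc k) 0)))
          (at u within {0..})"
        by (intro has_vector_derivative_diff has_vector_derivative_add has_vector_derivative_const
              Suc.prems(1) that zero_less_Suc)
      moreover have "g = (\<lambda>u. f 0 u - (f 0 0 + (\<Sum>k<n. (u ^ Suc k / fact (Suc k)) *\<^sub>R f (Suc k) 0)))"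
        unfolding g_def by (simp only: sum.lessThan_Suc_shift) simp
      ultimately show ?thesis
        by (simp only: g'_def One_nat_def add_0)
    qed
    have "norm (g t - g 0) \<le> B * t ^ Suc n / fact (Suc n) - B * 0 ^ Suc n / fact (Suc n)"
    proof (rule differentiable_bound_general[OF \<open>0 < t\<close>])
      show "continuous_on {0..t} g"
        by (rule continuous_on_subset[of "{0..}"])
           (auto intro!: continuous_on_vector_derivative g)
      show "continuous_on {0..t} (\<lambda>t. B * t ^ Suc n / fact (Suc n))"
        by (intro continuous_intros) auto
      fix u assume u: "0 < u" "u < t"
      show "(g has_vector_derivative g' u) (at u)"
        using g[of u] u by (simp add: at_within_interior[of u "{0..}"])
      show "((\<lambda>t. B * t ^ Suc n / fact (Suc n)) has_vector_derivative B * u ^ n / fact n) (at u)"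
        using DERIV_cmult[OF DERIV_power_fact[of n u UNIV], of B]
        by (simp only: has_real_derivative_iff_has_vector_derivative times_divide_eq_right)
      show "norm (g' u) \<le> B * u ^ n / fact n"
        using g'_bound u by simp
    qed
    moreover have "g 0 = 0"
      unfolding g_def by (simp only: sum.lessThan_Suc_shift) simp
    ultimately show ?thesis by (simp add: g_def)
  qed
qed

text \<open>The weights differentiate the Taylor polynomial \<open>P\<close> of the trajectory
  exactly at 0, so the error is the weighted sum of the remainders at the sampling times, divided by
  \<open>\<Delta>\<close>.\<close>

lemma phibe_drift_error:
  fixes \<mu> :: "real^'d \<Rightarrow> real^'d"
  assumes lip: "L-lipschitz_on UNIV \<mu>" and "1 \<le> i" "0 < \<Delta>"
    and diff: "\<forall>k<i. \<forall>s. (lie_op \<mu> ^^ k) \<mu> differentiable (at s)"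
    and bdd: "bounded (range ((lie_op \<mu> ^^ i) \<mu>))"
  shows "norm (phibe_drift i \<Delta> \<mu> s - \<mu> s)
    \<le> phibe_const i * Linf_vec ((lie_op \<mu> ^^ i) \<mu>) * \<Delta> ^ i"
proof -
  define a where "a = phibe_coeff i"
  define B where "B = Linf_vec ((lie_op \<mu> ^^ i) \<mu>)"
  obtain X where X: "ode_solution \<mu> s X"
    using lipschitz_ode_solution_exists[OF lip] by blast
  then have X0: "X 0 = s" by (simp add: ode_solution_def)
  \<comment> \<open>The index is shifted by one because entry 0 is the trajectory itself. Hence the
    \<open>i\<close>-th Lie derivative sits at \<open>i + 1\<close>, the order of the
    remainder.\<close>
  define f where "f = case_nat X (\<lambda>k t. (lie_op \<mu> ^^ k) \<mu> (X t))"
  define P where "P = (\<lambda>t. \<Sum>k<i + 1. (t ^ k / fact k) *\<^sub>R f k 0)"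
  have f_deriv: "(f m has_vector_derivative f (Suc m) t) (at t within {0..})"
    if "m < i + 1" "0 \<le> t" for m t
  proof (cases m)
    case 0
    then show ?thesis using X that by (simp add: f_def ode_solution_def)
  next
    case (Suc k)
    then show ?thesis
      using lie_op_along_solution[OF X \<open>0 \<le> t\<close>, of "(lie_op \<mu> ^^ k) \<mu>"] diff that
      by (simp add: f_def)
  qed
  have "norm (f (i + 1) t) \<le> B" for t
    using norm_le_Linf_vec[OF bdd, of "X t"] by (simp add: f_def B_def)
  then have taylor: "norm (X t - P t) \<le> B * t ^ (i + 1) / fact (i + 1)" if "0 \<le> t" for t
    using taylor_bound[of "i + 1" f B t] f_deriv that by (simp add: f_def P_def del: fact_Suc)
  have "phibe_drift i \<Delta> \<mu> s = (1 / \<Delta>) *\<^sub>R (\<Sum>j=1..i. a j *\<^sub>R (X (real j * \<Delta>) - s))"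
    using \<open>0 < \<Delta>\<close> by (simp add: phibe_drift_def a_def ode_flow_funpow[OF X lip])
  \<comment> \<open>The term for \<open>j = 0\<close> vanishes as \<open>X 0 = s\<close>; including
    it makes the moment conditions applicable.\<close>
  also have "(\<Sum>j=1..i. a j *\<^sub>R (X (real j * \<Delta>) - s)) = (\<Sum>j=0..i. a j *\<^sub>R (X (real j * \<Delta>) - s))"
    by (simp add: sum.atLeast_Suc_atMost[of 0] X0)
  also have "\<dots> = (\<Sum>j=0..i. a j *\<^sub>R X (real j * \<Delta>)) - (\<Sum>j=0..i. a j) *\<^sub>R s"
    by (simp add: scaleR_diff_right sum_subtractf scaleR_left.sum)
  also have "(\<Sum>j=0..i. a j) = 0"
    using sum_phibe_coeff[of 0 i] by (simp add: a_def)
  finally have drift: "phibe_drift i \<Delta> \<mu> s = (1 / \<Delta>) *\<^sub>R (\<Sum>j=0..i. a j *\<^sub>R X (real j * \<Delta>))"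
    by simp
  have "(\<Sum>j=0..i. a j *\<^sub>R P (real j * \<Delta>))
      = (\<Sum>j=0..i. \<Sum>k<i + 1. (\<Delta> ^ k / fact k * (a j * real j ^ k)) *\<^sub>R f k 0)"
    by (simp add: P_def scaleR_sum_right power_mult_distrib mult_ac del: sum.lessThan_Suc)
  also have "\<dots> = (\<Sum>k<i + 1. (\<Delta> ^ k / fact k * (\<Sum>j=0..i. a j * real j ^ k)) *\<^sub>R f k 0)"
    by (subst sum.swap) (simp add: sum_distrib_left scaleR_left.sum del: sum.lessThan_Suc)
  \<comment> \<open>Only the first moment survives, and \<open>1 \<le> i\<close> ensures that its
    index is in range.\<close>
  also have "\<dots> = (\<Sum>k<i + 1. if k = 1 then \<Delta> *\<^sub>R f 1 0 else 0)"
    by (intro sum.cong) (auto simp: a_def sum_phibe_coeff)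
  also have "\<dots> = \<Delta> *\<^sub>R \<mu> s"
    using \<open>1 \<le> i\<close> X0 by (simp add: f_def del: sum.lessThan_Suc)
  finally have main: "\<mu> s = (1 / \<Delta>) *\<^sub>R (\<Sum>j=0..i. a j *\<^sub>R P (real j * \<Delta>))"
    using \<open>0 < \<Delta>\<close> by simp
  have "phibe_drift i \<Delta> \<mu> s - \<mu> s
      = (1 / \<Delta>) *\<^sub>R (\<Sum>j=0..i. a j *\<^sub>R (X (real j * \<Delta>) - P (real j * \<Delta>)))"
    unfolding drift by (subst main) (simp only: scaleR_diff_right sum_subtractf)
  then have "norm (phibe_drift i \<Delta> \<mu> s - \<mu> s)
      = (1 / \<Delta>) * norm (\<Sum>j=0..i. a j *\<^sub>R (X (real j * \<Delta>) - P (real j * \<Delta>)))"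
    using \<open>0 < \<Delta>\<close> by simp
  also have "\<dots> \<le> (1 / \<Delta>) * (\<Sum>j=0..i. \<bar>a j\<bar> * (B * (real j * \<Delta>) ^ (i + 1) / fact (i + 1)))"
  proof (intro mult_left_mono sum_norm_le)
    fix j
    show "norm (a j *\<^sub>R (X (real j * \<Delta>) - P (real j * \<Delta>)))
        \<le> \<bar>a j\<bar> * (B * (real j * \<Delta>) ^ (i + 1) / fact (i + 1))"
      unfolding norm_scaleR using \<open>0 < \<Delta>\<close> by (intro mult_left_mono taylor) auto
  qed (use \<open>0 < \<Delta>\<close> in simp)
  also have "\<dots> = (1 / \<Delta>) * ((\<Sum>j=0..i. \<bar>a j\<bar> * real j ^ (i + 1)) * (B * \<Delta> ^ (i + 1) / fact (i + 1)))"
    by (subst sum_distrib_right) (simp add: power_mult_distrib mult_ac del: fact_Suc power_Suc)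
  also have "\<dots> = phibe_const i * B * \<Delta> ^ i"
    using \<open>0 < \<Delta>\<close> by (simp add: phibe_const_def a_def del: fact_Suc)
  finally show ?thesis by (simp add: B_def)
qed

section \<open>Stability of the value function\<close>

text \<open>For a nonnegative integrand the extended-real fundamental theorem delivers integrability
  and the value of the integral together.\<close>

lemma has_bochner_integral_FTC_atLeast_nonneg:
  fixes f :: "real \<Rightarrow> real"
  assumes f_borel: "f \<in> borel_measurable borel"
    and deriv: "\<And>x. a \<le> x \<Longrightarrow> DERIV F x :> f x"
    and nonneg: "\<And>x. a \<le> x \<Longrightarrow> 0 \<le> f x"
    and lim: "(F \<longlongrightarrow> T) at_top"
  shows "has_bochner_integral lborel (\<lambda>x. indicator {a..} x *\<^sub>R f x) (T - F a)"
proof (rule has_bochner_integral_nn_integral)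
  show "(\<lambda>x. indicator {a..} x *\<^sub>R f x) \<in> borel_measurable lborel"
    using f_borel by simp
  show "AE x in lborel. 0 \<le> indicator {a..} x *\<^sub>R f x"
    using nonneg by (auto simp: indicator_def)
  have "F a \<le> F x" if "a \<le> x" for x
    using that deriv nonneg by (intro DERIV_nonneg_imp_nondecreasing[of a x F]) auto
  then have "F a \<le> T"
    by (intro tendsto_lowerbound[OF lim]) (auto intro: eventually_mono[OF eventually_ge_at_top[of a]])
  then show "0 \<le> T - F a" by simp
  have "(\<integral>\<^sup>+x. ennreal (indicator {a..} x *\<^sub>R f x) \<partial>lborel)
      = (\<integral>\<^sup>+x. ennreal (f x) * indicator {a..} x \<partial>lborel)"
    by (intro nn_integral_cong) (auto simp: indicator_def)
  also have "\<dots> = ennreal (T - F a)"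
    by (rule nn_integral_FTC_atLeast[OF f_borel deriv nonneg lim])
  finally show "(\<integral>\<^sup>+x. ennreal (indicator {a..} x *\<^sub>R f x) \<partial>lborel) = ennreal (T - F a)" .
qed

lemma set_integrable_exp_minus:
  fixes c :: real
  assumes "0 < c"
  shows "set_integrable lborel {0..} (\<lambda>t. exp (- c * t))"
proof -
  have "has_bochner_integral lborel (\<lambda>t. indicator {0..} t *\<^sub>R exp (- c * t)) (0 - (- exp (- c * 0) / c))"
  proof (rule has_bochner_integral_FTC_atLeast_nonneg)
    show "((\<lambda>t. - exp (- c * t) / c) \<longlongrightarrow> 0) at_top"
      using assms by real_asymp
  qed (use assms in \<open>auto intro!: derivative_eq_intros\<close>)
  then show ?thesis
    unfolding set_integrable_def by (rule integrable.intros)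
qed

text \<open>With \<open>c = \<beta> - M\<close> this integral is the source of the squared
  denominator in the error bound.\<close>

lemma has_bochner_integral_ident_exp_minus:
  fixes c :: real
  assumes "0 < c"
  shows "has_bochner_integral lborel (\<lambda>t. indicator {0..} t *\<^sub>R (t * exp (- c * t))) (1 / c\<^sup>2)"
proof -
  \<comment> \<open>Antiderivative obtained by integration by parts.\<close>
  define F where "F = (\<lambda>t. - (t / c + 1 / c\<^sup>2) * exp (- c * t))"
  have "has_bochner_integral lborel (\<lambda>t. indicator {0..} t *\<^sub>R (t * exp (- c * t))) (0 - F 0)"
  proof (rule has_bochner_integral_FTC_atLeast_nonneg)
    show "(F \<longlongrightarrow> 0) at_top"
      unfolding F_def using assms by real_asymp
    show "DERIV F t :> t * exp (- c * t)" for t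
      unfolding F_def using assms
      by (auto intro!: derivative_eq_intros simp: field_simps power2_eq_square)
  qed auto
  then show ?thesis by (simp add: F_def)
qed

lemma value_fun_eq:
  assumes "ode_solution F s X" "L-lipschitz_on UNIV F"
  shows "value_fun \<beta> r F s = (LINT t:{0..}|lborel. exp (- \<beta> * t) * r (X t))"
  unfolding value_fun_def
  by (rule set_lebesgue_integral_cong) (auto simp: ode_flow_eq[OF assms])

text \<open>A bounded reward is dominated by a multiple of \<open>exp (- \<beta> * t)\<close>.
  Integrability allows the difference of two value functions to be written as one integral.\<close>

lemma set_integrable_discounted:
  assumes "0 < \<beta>" "bounded (range r)" "continuous_on UNIV r" "ode_solution F s X"
  shows "set_integrable lborel {0..} (\<lambda>t. exp (- \<beta> * t) * r (X t))"
proof -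
  obtain B where B: "\<And>x. \<bar>r x\<bar> \<le> B"
    using assms(2) by (auto simp: bounded_iff)
  have "continuous_on {0..} X"
    using assms(4) unfolding ode_solution_def by (intro continuous_on_vector_derivative) auto
  then have cont: "continuous_on {0..} (\<lambda>t. exp (- \<beta> * t) * r (X t))"
    by (intro continuous_intros continuous_on_compose2[OF assms(3)]) auto
  have meas: "set_borel_measurable lborel {0..} (\<lambda>t. exp (- \<beta> * t) * r (X t))"
    unfolding set_borel_measurable_def
    using borel_measurable_continuous_on_indicator[OF borel_closed[OF closed_atLeast] cont] by simp
  have dominating: "set_integrable lborel {0..} (\<lambda>t. B * exp (- \<beta> * t))"
    using set_integrable_exp_minus[OF \<open>0 < \<beta>\<close>] by simp
  have "norm (exp (- \<beta> * t) * r (X t)) \<le> norm (B * exp (- \<beta> * t))" for t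
    using B[of "X t"] by (simp add: abs_mult)
  then show ?thesis
    by (intro set_integrable_bound[OF dominating meas] AE_I2 impI)
qed

lemma value_fun_diff_bound:
  fixes F G :: "real^'d \<Rightarrow> real^'d"
  assumes "0 < \<beta>" "bounded (range r)"
    and r_lip: "\<And>x y. \<bar>r x - r y\<bar> \<le> R * norm (x - y)"
    and F: "\<exists>C. C-lipschitz_on UNIV F" and G: "M-lipschitz_on UNIV G" and "M < \<beta>"
    and close: "\<And>s. norm (F s - G s) \<le> \<epsilon>"
  shows "\<bar>value_fun \<beta> r F s - value_fun \<beta> r G s\<bar> \<le> R * \<epsilon> / (\<beta> - M)\<^sup>2"
proof -
  obtain C where C: "C-lipschitz_on UNIV F" using F by blast
  obtain X Y where X: "ode_solution F s X" and Y: "ode_solution G s Y"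
    using lipschitz_ode_solution_exists[OF C] lipschitz_ode_solution_exists[OF G] by blast
  have "0 \<le> R"
    using order_trans[OF abs_ge_zero r_lip[of "axis undefined 1" 0]] by simp
  then have "R-lipschitz_on UNIV r"
    using r_lip by (intro lipschitz_onI) (auto simp: dist_norm)
  then have r_cont: "continuous_on UNIV r"
    by (rule lipschitz_on_continuous_on)
  note int = set_integrable_discounted[OF assms(1,2) r_cont X]
    set_integrable_discounted[OF assms(1,2) r_cont Y]
  note int' = set_integral_diff[OF int]
  \<comment> \<open>Discount factor times \<open>R\<close> times the trajectory distance
    \<open>exp (M * t) * (\<epsilon> * t)\<close>.\<close>
  define h where "h = (\<lambda>t. R * \<epsilon> * (t * exp (- (\<beta> - M) * t)))"
  have te: "has_bochner_integral lborel
      (\<lambda>t. indicator {0..} t *\<^sub>R (t * exp (- (\<beta> - M) * t))) (1 / (\<beta> - M)\<^sup>2)"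
    using \<open>M < \<beta>\<close> by (intro has_bochner_integral_ident_exp_minus) simp
  have h: "has_bochner_integral lborel (\<lambda>t. indicator {0..} t *\<^sub>R h t) (R * \<epsilon> * (1 / (\<beta> - M)\<^sup>2))"
    using has_bochner_integral_mult_right[OF te, of "R * \<epsilon>"]
    by (simp add: h_def mult_ac)
  have "\<bar>value_fun \<beta> r F s - value_fun \<beta> r G s\<bar>
      = norm (LINT t:{0..}|lborel. exp (- \<beta> * t) * r (X t) - exp (- \<beta> * t) * r (Y t))"
    by (simp only: value_fun_eq[OF X C] value_fun_eq[OF Y G] int'(2) real_norm_def)
  also have "\<dots> \<le> (LINT t:{0..}|lborel. norm (exp (- \<beta> * t) * r (X t) - exp (- \<beta> * t) * r (Y t)))"
    by (rule set_integral_norm_bound[OF int'(1)])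
  also have "\<dots> \<le> (LINT t:{0..}|lborel. h t)"
  proof (rule set_integral_mono)
    show "set_integrable lborel {0..} (\<lambda>t. norm (exp (- \<beta> * t) * r (X t) - exp (- \<beta> * t) * r (Y t)))"
      by (rule set_integrable_norm[OF int'(1)])
    show "set_integrable lborel {0..} h"
      using h unfolding set_integrable_def by (rule integrable.intros)
    fix t :: real assume "t \<in> {0..}"
    then have "\<bar>r (X t) - r (Y t)\<bar> \<le> R * (exp (M * t) * (\<epsilon> * t))"
      using r_lip[of "X t" "Y t"] ode_solution_diff_bound[OF X Y G close, of t] \<open>0 \<le> R\<close>
      by (simp add: order_trans[OF _ mult_left_mono])
    then have "exp (- \<beta> * t) * \<bar>r (X t) - r (Y t)\<bar> \<le> exp (- \<beta> * t) * (R * (exp (M * t) * (\<epsilon> * t)))"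
      by (intro mult_left_mono) auto
    also have "\<dots> = h t"
      by (simp add: h_def algebra_simps mult_exp_exp)
    finally show "norm (exp (- \<beta> * t) * r (X t) - exp (- \<beta> * t) * r (Y t)) \<le> h t"
      by (simp add: abs_mult flip: right_diff_distrib)
  qed
  also have "\<dots> = R * \<epsilon> / (\<beta> - M)\<^sup>2"
    using has_bochner_integral_integral_eq[OF h] by (simp add: set_lebesgue_integral_def)
  finally show ?thesis .
qed

theorem theorem3p2:
  fixes r :: "real^'d \<Rightarrow> real"
    and \<mu> :: "real^'d \<Rightarrow> real^'d"
    and \<beta> \<Delta> :: real
    and i :: nat
  assumes "\<beta> > 0"
    and "bounded (range r)"
    and "\<exists>L. L-lipschitz_on UNIV \<mu>"
    and "i \<ge> 1"
    and "\<Delta> > 0"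
    and "\<forall>s. r differentiable (at s)"
    and "bounded (range (grad r))"
    and "\<forall>k<i. \<forall>s. (lie_op \<mu> ^^ k) \<mu> differentiable (at s)"
    and "bounded (range ((lie_op \<mu> ^^ i) \<mu>))"
    and "bounded (range (grad_vec \<mu>))"
    and "Linf_mat (grad_vec \<mu>) < \<beta>"
  shows "bounded (range (\<lambda>s. phibe_solution i \<Delta> \<beta> r \<mu> s - value_fun \<beta> r \<mu> s)) \<and>
    Linf (\<lambda>s. phibe_solution i \<Delta> \<beta> r \<mu> s - value_fun \<beta> r \<mu> s)
      \<le> 2 * phibe_const i
          * (Linf_vec (grad r) * Linf_vec ((lie_op \<mu> ^^ i) \<mu>) / (\<beta> - Linf_mat (grad_vec \<mu>))\<^sup>2)
          * \<Delta> ^ i"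
proof -
  define b where "b = phibe_const i
      * (Linf_vec (grad r) * Linf_vec ((lie_op \<mu> ^^ i) \<mu>) / (\<beta> - Linf_mat (grad_vec \<mu>))\<^sup>2)
      * \<Delta> ^ i"
  \<comment> \<open>This is the instance \<open>k = 0\<close> of the differentiability hypothesis,
    available because \<open>1 \<le> i\<close>.\<close>
  have "\<forall>s. \<mu> differentiable (at s)"
    using assms(4,8) by force
  then have lip: "(Linf_mat (grad_vec \<mu>))-lipschitz_on UNIV \<mu>"
    using assms(10) by (rule grad_vec_bound_lipschitz)
  have bound: "\<bar>phibe_solution i \<Delta> \<beta> r \<mu> s - value_fun \<beta> r \<mu> s\<bar> \<le> b" for s
  proof -
    have "\<bar>phibe_solution i \<Delta> \<beta> r \<mu> s - value_fun \<beta> r \<mu> s\<bar>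
        \<le> Linf_vec (grad r) * (phibe_const i * Linf_vec ((lie_op \<mu> ^^ i) \<mu>) * \<Delta> ^ i)
          / (\<beta> - Linf_mat (grad_vec \<mu>))\<^sup>2"
      unfolding phibe_solution_def
      using assms lip
      by (intro value_fun_diff_bound phibe_drift_error grad_bound_lipschitz
            phibe_drift_lipschitz[OF lip]) auto
    then show ?thesis by (simp add: b_def mult_ac)
  qed
  have "Linf (\<lambda>s. phibe_solution i \<Delta> \<beta> r \<mu> s - value_fun \<beta> r \<mu> s) \<le> b"
    unfolding Linf_def by (rule cSUP_least) (auto intro: bound)
  \<comment> \<open>\<open>b\<close> bounds an absolute value and is therefore nonnegative.\<close>
  also have "b \<le> 2 * b"
    using order_trans[OF abs_ge_zero bound] by simp
  finally show ?thesis
    using bound by (auto simp: bounded_iff b_def)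
qed

end
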